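(* Let $f_1,\dots,f_m$ be real-valued functions of $Z$, let $\theta,\tilde\theta\in\Theta$, and let $C_{\tilde\theta}$ be the $m\times m$ matrix with entries $[C_{\tilde\theta}]_{jk}=\frac1n\sum_{i=1}^n f_j(Z_i)f_k(Z_i)(Y_i-g(X_i;\tilde\theta))^2$, assumed invertible. Let $\|v\|_{\tilde\theta}^2=v^TC_{\tilde\theta}^{-1}v$ for $v\in\mathbb R^m$, and let $\mathcal F=\operatorname{span}(f_1,\dots,f_m)$. Then $$\left\|(\psi_n(f_1;\theta),\dots,\psi_n(f_m;\theta))\right\|_{\tilde\theta}^2=\Psi_n(\theta;\mathcal F,\tilde\theta),$$ where $$\Psi_n(\theta;\mathcal F,\tilde\theta)=\sup_{f\in\mathcal F}\left\{\psi_n(f;\theta)-\frac14\mathcal C_{\tilde\theta}(f,f)\right\}.$$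
   Context: Data $(X_i,Y_i,Z_i)$, $i=1,\dots,n$, are given, with $Y_i\in\mathbb R$. $\{g(\cdot;\theta):\theta\in\Theta\}$ is a parametrized family of real-valued functions of $X$. For real-valued functions $f,h$ of $Z$ (which form a vector space under the usual operations) and $\theta\in\Theta$, define $$\psi_n(f;\theta)=\frac1n\sum_{i=1}^n f(Z_i)(Y_i-g(X_i;\theta)),\qquad \mathcal C_{\theta}(f,h)=\frac1n\sum_{i=1}^n f(Z_i)h(Z_i)(Y_i-g(X_i;\theta))^2.$$ $\operatorname{span}(f_1,\dots,f_m)$ is the linear span in the space of real-valued functions of $Z$. *)

theory Defs
  imports "HOL-Analysis.Analysis" "HOL-Library.Function_Algebras"
begin

text \<open>Functions into a real vector space form a real vector space pointwise, so that
  \<^const>\<open>span\<close> is available for sets of real-valued functions on an arbitrary type.\<close>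

instantiation "fun" :: (type, real_vector) real_vector
begin

definition scaleR_fun_def: "c *\<^sub>R f = (\<lambda>z. c *\<^sub>R f z)"

instance
  by standard (simp_all add: scaleR_fun_def fun_eq_iff scaleR_add_right scaleR_add_left)

end

lemma scaleR_fun_apply [simp]: "(c *\<^sub>R f) z = c *\<^sub>R f z"
  by (simp add: scaleR_fun_def)

text \<open>The data are sequences \<open>X\<close>, \<open>Y\<close>, \<open>Z\<close>, of which only the entries \<open>1, \<dots>, n\<close> are used.\<close>

definition psi_n ::
  "nat \<Rightarrow> (nat \<Rightarrow> 'x) \<Rightarrow> (nat \<Rightarrow> real) \<Rightarrow> (nat \<Rightarrow> 'z) \<Rightarrow> ('x \<Rightarrow> 'p \<Rightarrow> real)
    \<Rightarrow> ('z \<Rightarrow> real) \<Rightarrow> 'p \<Rightarrow> real" where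
  "psi_n n X Y Z g f \<theta> = 1 / real n * (\<Sum>i=1..n. f (Z i) * (Y i - g (X i) \<theta>))"

definition cov_n ::
  "nat \<Rightarrow> (nat \<Rightarrow> 'x) \<Rightarrow> (nat \<Rightarrow> real) \<Rightarrow> (nat \<Rightarrow> 'z) \<Rightarrow> ('x \<Rightarrow> 'p \<Rightarrow> real)
    \<Rightarrow> 'p \<Rightarrow> ('z \<Rightarrow> real) \<Rightarrow> ('z \<Rightarrow> real) \<Rightarrow> real" where
  "cov_n n X Y Z g \<theta> f h =
    1 / real n * (\<Sum>i=1..n. f (Z i) * h (Z i) * (Y i - g (X i) \<theta>)\<^sup>2)"

definition cov_matrix ::
  "nat \<Rightarrow> (nat \<Rightarrow> 'x) \<Rightarrow> (nat \<Rightarrow> real) \<Rightarrow> (nat \<Rightarrow> 'z) \<Rightarrow> ('x \<Rightarrow> 'p \<Rightarrow> real)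
    \<Rightarrow> ('m::finite \<Rightarrow> 'z \<Rightarrow> real) \<Rightarrow> 'p \<Rightarrow> real ^ 'm ^ 'm" where
  "cov_matrix n X Y Z g f \<theta> = (\<chi> j k. cov_n n X Y Z g \<theta> (f j) (f k))"

text \<open>The squared norm with weight matrix \<open>C\<close>; meaningful only for invertible \<open>C\<close>, since
  \<^const>\<open>matrix_inv\<close> is unspecified otherwise.\<close>

definition weighted_norm_sq :: "real ^ 'm ^ 'm \<Rightarrow> real ^ 'm \<Rightarrow> real" where
  "weighted_norm_sq C v = v \<bullet> (matrix_inv C *v v)"

text \<open>The supremum is taken in the extended reals: it is \<open>\<infinity>\<close> when the objective is unbounded
  above on \<open>F\<close>, whereas the supremum in \<^typ>\<open>real\<close> would then be an arbitrary number.\<close>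

definition Psi_n ::
  "nat \<Rightarrow> (nat \<Rightarrow> 'x) \<Rightarrow> (nat \<Rightarrow> real) \<Rightarrow> (nat \<Rightarrow> 'z) \<Rightarrow> ('x \<Rightarrow> 'p \<Rightarrow> real)
    \<Rightarrow> 'p \<Rightarrow> ('z \<Rightarrow> real) set \<Rightarrow> 'p \<Rightarrow> ereal" where
  "Psi_n n X Y Z g \<theta> F \<theta>' =
    (SUP f\<in>F. ereal (psi_n n X Y Z g f \<theta> - 1 / 4 * cov_n n X Y Z g \<theta>' f f))"

end

theory Submission
  imports Defs
begin

text \<open>Writing \<open>f = \<Sum>\<^sub>j a\<^sub>j f\<^sub>j\<close> turns the objective into \<open>a \<bullet> v - 1/4 a \<bullet> C a\<close>, where \<open>v\<close> is the vector
  of the \<open>\<psi>\<^sub>n(f\<^sub>j; \<theta>)\<close>. The matrix \<open>C\<close> is symmetric and positive semidefinite, being a Gram matrix.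
  With \<open>w = C\<^sup>-\<^sup>1 v\<close>, completing the square gives
  \<open>a \<bullet> v - 1/4 a \<bullet> C a = v \<bullet> w - 1/4 (a - 2 w) \<bullet> C (a - 2 w)\<close>, which is maximal at \<open>a = 2 w\<close>.\<close>

lemma sum_fun_apply: "(\<Sum>j\<in>A. h j) z = (\<Sum>j\<in>A. h j z :: 'b::comm_monoid_add)"
  by (induction A rule: infinite_finite_induct) simp_all

text \<open>The image of a linear map is a subspace, and it contains each \<open>f j\<close> as the
  image of an axis vector. This replaces the supremum over a function space by one over coefficient
  vectors.\<close>

lemma span_range_eq:
  fixes f :: "'m::finite \<Rightarrow> 'v::real_vector"
  shows "span (range f) = range (\<lambda>a :: real ^ 'm. \<Sum>j\<in>UNIV. a $ j *\<^sub>R f j)" (is "_ = range ?L")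
proof
  have "linear ?L"
    by (rule linearI) (simp_all add: scaleR_left_distrib sum.distrib scaleR_sum_right)
  moreover have "f j = ?L (axis j 1)" for j
    by (simp add: axis_def if_distrib[of "\<lambda>c. c *\<^sub>R _"] cong: if_cong)
  then have "range f \<subseteq> range ?L"
    by blast
  ultimately show "span (range f) \<subseteq> range ?L"
    by (intro span_minimal linear_subspace_image subspace_UNIV)
next
  show "range ?L \<subseteq> span (range f)"
    by (intro image_subsetI span_sum span_scale span_base rangeI)
qed

lemma psi_n_sum_scaleR:
  "psi_n n X Y Z g (\<Sum>j\<in>A. u j *\<^sub>R f j) \<theta> = (\<Sum>j\<in>A. u j * psi_n n X Y Z g (f j) \<theta>)"
proof -
  have "(\<Sum>i=1..n. (\<Sum>j\<in>A. u j *\<^sub>R f j) (Z i) * (Y i - g (X i) \<theta>))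
    = (\<Sum>i=1..n. \<Sum>j\<in>A. u j * (f j (Z i) * (Y i - g (X i) \<theta>)))"
    by (simp add: sum_fun_apply sum_distrib_right mult.assoc)
  also have "\<dots> = (\<Sum>j\<in>A. u j * (\<Sum>i=1..n. f j (Z i) * (Y i - g (X i) \<theta>)))"
    by (subst sum.swap) (simp add: sum_distrib_left)
  finally show ?thesis
    by (simp add: psi_n_def sum_distrib_left sum_divide_distrib)
qed

lemma cov_n_commute: "cov_n n X Y Z g \<theta> f h = cov_n n X Y Z g \<theta> h f"
  by (simp add: cov_n_def mult.commute)

lemma cov_n_nonneg: "0 \<le> cov_n n X Y Z g \<theta> f f"
  by (simp add: cov_n_def sum_nonneg)

lemma cov_n_sum_scaleR_left:
  "cov_n n X Y Z g \<theta> (\<Sum>j\<in>A. u j *\<^sub>R f j) h = (\<Sum>j\<in>A. u j * cov_n n X Y Z g \<theta> (f j) h)"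
proof -
  have "(\<Sum>i=1..n. (\<Sum>j\<in>A. u j *\<^sub>R f j) (Z i) * h (Z i) * (Y i - g (X i) \<theta>)\<^sup>2)
    = (\<Sum>i=1..n. \<Sum>j\<in>A. u j * (f j (Z i) * h (Z i) * (Y i - g (X i) \<theta>)\<^sup>2))"
    by (simp add: sum_fun_apply sum_distrib_right mult.assoc)
  also have "\<dots> = (\<Sum>j\<in>A. u j * (\<Sum>i=1..n. f j (Z i) * h (Z i) * (Y i - g (X i) \<theta>)\<^sup>2))"
    by (subst sum.swap) (simp add: sum_distrib_left)
  finally show ?thesis
    by (simp add: cov_n_def sum_distrib_left sum_divide_distrib)
qed

text \<open>Bilinearity of \<open>cov_n\<close>. Besides rewriting the objective, it carries
  nonnegativity of \<open>cov_n\<close> over to the matrix.\<close>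

lemma cov_n_eq_quadratic_form:
  "cov_n n X Y Z g \<theta> (\<Sum>j\<in>UNIV. a $ j *\<^sub>R f j) (\<Sum>j\<in>UNIV. a $ j *\<^sub>R f j)
    = a \<bullet> (cov_matrix n X Y Z g f \<theta> *v a)"
proof -
  \<comment> \<open>Linearity in the second argument comes from the first by symmetry.\<close>
  have "cov_n n X Y Z g \<theta> (f j) (\<Sum>k\<in>UNIV. a $ k *\<^sub>R f k)
    = (cov_matrix n X Y Z g f \<theta> *v a) $ j" for j
    unfolding cov_n_commute[of n X Y Z g \<theta> "f j"] cov_n_sum_scaleR_left
    by (simp add: cov_matrix_def matrix_vector_mult_def mult.commute
        cov_n_commute[of n X Y Z g \<theta> "f j"])
  then show ?thesis
    by (simp add: cov_n_sum_scaleR_left inner_vec_def)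
qed

lemma transpose_cov_matrix: "transpose (cov_matrix n X Y Z g f \<theta>) = cov_matrix n X Y Z g f \<theta>"
  by (simp add: transpose_def cov_matrix_def vec_eq_iff cov_n_commute)

lemma SUP_concave_quadratic:
  fixes C :: "real ^ 'm ^ 'm"
  assumes sym: "transpose C = C" and psd: "\<And>a. 0 \<le> a \<bullet> (C *v a)" and inv: "invertible C"
  shows "(SUP a. ereal (a \<bullet> v - 1 / 4 * (a \<bullet> (C *v a)))) = ereal (weighted_norm_sq C v)"
proof -
  define w where "w = matrix_inv C *v v"
  \<comment> \<open>\<open>matrix_inv\<close> is a Hilbert choice; invertibility supplies the
    witness.\<close>
  have "C ** matrix_inv C = mat 1"
    using someI_ex[OF inv[unfolded invertible_def]] by (simp add: matrix_inv_def)
  then have Cw: "C *v w = v"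
    by (simp add: w_def matrix_vector_mul_assoc)
  have selfadj: "x \<bullet> (C *v y) = y \<bullet> (C *v x)" for x y
    using dot_lmul_matrix[of x C y] sym
    by (metis inner_commute transpose_matrix_vector)
  \<comment> \<open>By \<open>selfadj\<close> and \<open>Cw\<close>, both cross terms equal
    \<open>a \<bullet> v\<close>.\<close>
  have square: "a \<bullet> v - 1 / 4 * (a \<bullet> (C *v a))
    = weighted_norm_sq C v - 1 / 4 * ((a - 2 *\<^sub>R w) \<bullet> (C *v (a - 2 *\<^sub>R w)))" for a
    using selfadj[of w a] Cw
    by (simp add: weighted_norm_sq_def flip: w_def)
      (simp add: matrix_vector_mult_diff_distrib matrix_vector_mult_scaleR
        inner_diff_left inner_diff_right inner_commute[of w v] field_simps)
  show ?thesis
  proof (rule antisym)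
    show "(SUP a. ereal (a \<bullet> v - 1 / 4 * (a \<bullet> (C *v a)))) \<le> ereal (weighted_norm_sq C v)"
      by (rule SUP_least) (simp only: square, simp add: psd)
    \<comment> \<open>The witness solves the stationarity equation \<open>v = (1/2) C a\<close>;
      there the subtracted square vanishes.\<close>
    show "ereal (weighted_norm_sq C v) \<le> (SUP a. ereal (a \<bullet> v - 1 / 4 * (a \<bullet> (C *v a))))"
      by (rule SUP_upper2[of "2 *\<^sub>R w"]) (simp_all only: square, simp_all)
  qed
qed

theorem lemma1:
  fixes n :: nat
    and X :: "nat \<Rightarrow> 'x" and Y :: "nat \<Rightarrow> real" and Z :: "nat \<Rightarrow> 'z"
    and \<Theta> :: "'p set" and g :: "'x \<Rightarrow> 'p \<Rightarrow> real"
    and f :: "'m::finite \<Rightarrow> 'z \<Rightarrow> real"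
    and \<theta> \<theta>' :: 'p
  assumes "\<theta> \<in> \<Theta>" and "\<theta>' \<in> \<Theta>"
    and "invertible (cov_matrix n X Y Z g f \<theta>')"
  shows "ereal (weighted_norm_sq (cov_matrix n X Y Z g f \<theta>') (\<chi> j. psi_n n X Y Z g (f j) \<theta>))
    = Psi_n n X Y Z g \<theta> (span (range f)) \<theta>'"
proof -
  let ?C = "cov_matrix n X Y Z g f \<theta>'" and ?v = "\<chi> j. psi_n n X Y Z g (f j) \<theta>"
  \<comment> \<open>The form is an average of the squares of f(Z i) times the residual at
    \<open>\<theta>'\<close>, with f the combination of the \<open>f j\<close> with coefficients
    \<open>a\<close>.\<close>
  have "0 \<le> a \<bullet> (?C *v a)" for a
    unfolding cov_n_eq_quadratic_form[symmetric] by (rule cov_n_nonneg)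
  with assms(3) have "ereal (weighted_norm_sq ?C ?v) = (SUP a. ereal (a \<bullet> ?v - 1 / 4 * (a \<bullet> (?C *v a))))"
    by (intro SUP_concave_quadratic[symmetric] transpose_cov_matrix)
  also have "\<dots> = Psi_n n X Y Z g \<theta> (span (range f)) \<theta>'"
    \<comment> \<open>\<open>image_image\<close> reindexes the supremum by coefficient
      vectors.\<close>
    unfolding Psi_n_def span_range_eq image_image psi_n_sum_scaleR cov_n_eq_quadratic_form
    by (simp add: inner_vec_def)
  finally show ?thesis .
qed

end
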